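(* Let $N\ge 1$ and let $\mathcal{J}'$ be a nonempty finite multiset of permutations in $\mathfrak{S}_{N-1}$. Let $\mathcal{J}$ be the multiset in $\mathfrak{S}_N$ obtained by appending $N$ to each element of $\mathcal{J}'$, and let $\mathcal{I}$ be a strategy-indifferent game that has $\mathcal{J}'$ as its bine of competitors. Then the win probability of the game defined by $\mathcal{I}$ is $$\frac{1}{E_{\mathsf{LRM}}(\mathcal{J}')+1}=\frac{1}{E_{\mathsf{LRM}}(\mathcal{J})},$$ and $|\mathcal{I}|=|\mathcal{J}'|\,(E_{\mathsf{LRM}}(\mathcal{J}')+1)$.
   Context: $\mathfrak{S}_N$ is the set of permutations of $\{1,\dots,N\}$ in one-line notation ($\mathfrak{S}_0$ consists of the empty permutation). The flattening of a sequence of $i$ distinct integers is the unique permutation of $\{1,\dots,i\}$ with the same relative order. For a permutation $\pi$, $\pi|_{[i]}$ denotes the flattening of $\pi_1,\dots,\pi_i$. Game of best choice defined by a multiset $\mathcal{I}$ of elements of $\mathfrak{S}_N$: $\pi\in\mathcal{I}$ is chosen uniformly at random (each element weighted by its multiplicity; $|\mathcal{I}|$ is the sum of the multiplicities), and $\pi|_{[1]},\pi|_{[2]},\dots$ are presented sequentially to the player, who may stop at one position. The player wins if they stop at position $i$ with $\pi_i=N$, and loses otherwise. A strategy is given by a strike set $A$ of prefixes: the player stops at the first $i$ for which $\pi|_{[i]}\in A$ (and loses if there is no such $i$). An entry $\pi_j$ is a left-to-right maximum if $\pi_i<\pi_j$ for all $i<j$; then $j$ is a left-to-right maximum position. A permutation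 in $\bigcup_{i=1}^N\mathfrak{S}_i$ is an eligible prefix if its last entry is a left-to-right maximum. The prefix tree $\mathcal{P}_N$ is the set of all eligible prefixes in $\bigcup_{i=1}^N\mathfrak{S}_i$, partially ordered by containment: $q$ contains $p$ if $q|_{[i]}=p$, where $i$ is the size of $p$. A maximal antichain in $\mathcal{P}_N$ is a subset $A\subseteq\mathcal{P}_N$ with no two distinct elements comparable and such that every element of $\mathcal{P}_N$ contains or is contained in some element of $A$. $\mathcal{I}$ is strategy-indifferent if every strike set that is a maximal antichain in $\mathcal{P}_N$ has the same probability of winning; this common value is the win probability. $\mathcal{I}$ has $\mathcal{J}'$ as its bine of competitors if $\mathcal{I}$ is obtained as follows: for each $\pi\in\mathcal{J}$ (with multiplicity) and each left-to-right maximum position $i$ of $\pi$, include in $\mathcal{I}$ one permutation $\widetilde{\pi}\in\mathfrak{S}_N$, chosen arbitrarily subject to $\widetilde{\pi}|_{[i]}=\pi|_{[i]}$ and $\widetilde{\pi}_i=N$. For a nonempty finite multiset $\mathcal{K}$ of permutations, $E_{\mathsf{LRM}}(\mathcal{K})=\frac{1}{|\mathcal{K}|}\sum_{\pi\in\mathcal{K}}\mathrm{lrm}(\pi)$, where $\mathrm{lrm}(\pi)$ is the number of left-to-right maxima of $\pi$ (sum with multiplicity). *)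

theory Defs
  imports "HOL-Probability.Probability" "HOL-Combinatorics.Multiset_Permutations"
begin

text \<open>Permutations of \<open>{1..n}\<close> are lists in one-line notation, and positions are counted from 1.\<close>

abbreviation perms :: "nat \<Rightarrow> nat list set" where
  "perms n \<equiv> permutations_of_set {1..n}"

definition entry :: "nat list \<Rightarrow> nat \<Rightarrow> nat" where
  "entry xs i = xs ! (i - 1)"

definition same_order :: "nat list \<Rightarrow> nat list \<Rightarrow> bool" where
  "same_order xs ys \<longleftrightarrow> length xs = length ys \<and>
     (\<forall>i<length xs. \<forall>j<length xs. xs ! i < xs ! j \<longleftrightarrow> ys ! i < ys ! j)"

definition flattening :: "nat list \<Rightarrow> nat list" where
  "flattening xs = (THE \<sigma>. \<sigma> \<in> perms (length xs) \<and> same_order \<sigma> xs)"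

lemma flattening_rank:
  assumes "distinct xs"
  shows "map (\<lambda>x. card {y \<in> set xs. y \<le> x}) xs \<in> perms (length xs)" (is "?r \<in> _")
    and "same_order (map (\<lambda>x. card {y \<in> set xs. y \<le> x}) xs) xs"
proof -
  let ?f = "\<lambda>x. card {y \<in> set xs. y \<le> x}"
  have less: "?f x < ?f y" if "x \<in> set xs" "y \<in> set xs" "x < y" for x y
  proof (rule psubset_card_mono)
    have "y \<in> {z \<in> set xs. z \<le> y}" "y \<notin> {z \<in> set xs. z \<le> x}"
      "{z \<in> set xs. z \<le> x} \<subseteq> {z \<in> set xs. z \<le> y}"
      using that by auto
    then show "{z \<in> set xs. z \<le> x} \<subset> {z \<in> set xs. z \<le> y}" by blast
  qed simp
  have iff: "?f x < ?f y \<longleftrightarrow> x < y" if "x \<in> set xs" "y \<in> set xs" for x y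
    using less[of x y] less[of y x] that by (cases x y rule: linorder_cases) auto
  show "same_order ?r xs"
    unfolding same_order_def using iff by simp
  have inj: "inj_on ?f (set xs)"
  proof (rule inj_onI)
    fix x y assume "x \<in> set xs" "y \<in> set xs" "?f x = ?f y"
    then show "x = y"
      using less[of x y] less[of y x] by (cases x y rule: linorder_cases) auto
  qed
  have "?f ` set xs \<subseteq> {1..length xs}"
  proof safe
    fix x assume "x \<in> set xs"
    then have "?f x > 0" by (auto simp: card_gt_0_iff)
    moreover have "?f x \<le> card (set xs)" by (intro card_mono) auto
    ultimately show "?f x \<in> {1..length xs}"
      using card_length[of xs] by auto
  qed
  then have "?f ` set xs = {1..length xs}"
    by (intro card_subset_eq) (auto simp: card_image[OF inj] distinct_card[OF assms])
  then show "?r \<in> perms (length xs)"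
    using assms inj by (auto intro!: permutations_of_setI simp: distinct_map)
qed

lemma flattening_eq:
  assumes "distinct xs"
  shows "flattening xs = map (\<lambda>x. card {y \<in> set xs. y \<le> x}) xs"
  unfolding flattening_def
proof (rule the_equality)
  show "map (\<lambda>x. card {y \<in> set xs. y \<le> x}) xs \<in> perms (length xs) \<and>
      same_order (map (\<lambda>x. card {y \<in> set xs. y \<le> x}) xs) xs"
    using flattening_rank[OF assms] by blast
next
  fix \<sigma> assume \<sigma>: "\<sigma> \<in> perms (length xs) \<and> same_order \<sigma> xs"
  have set: "set \<sigma> = {1..length xs}" and dist: "distinct \<sigma>" and len: "length \<sigma> = length xs"
    using \<sigma> by (auto dest: permutations_of_setD simp: same_order_def)
  show "\<sigma> = map (\<lambda>x. card {y \<in> set xs. y \<le> x}) xs"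
  proof (rule nth_equalityI)
    fix i assume "i < length \<sigma>"
    then have i: "i < length xs" using len by simp
    have ord: "\<sigma> ! j \<le> \<sigma> ! i \<longleftrightarrow> xs ! j \<le> xs ! i" if "j < length xs" for j
      using \<sigma> that i len by (auto simp: same_order_def linorder_not_less[symmetric])
    have "{y \<in> set xs. y \<le> xs ! i} = (!) xs ` {j. j < length xs \<and> \<sigma> ! j \<le> \<sigma> ! i}"
      using ord by (auto simp: in_set_conv_nth)
    then have "card {y \<in> set xs. y \<le> xs ! i} = card {j. j < length xs \<and> \<sigma> ! j \<le> \<sigma> ! i}"
      using assms by (simp add: card_image inj_on_def nth_eq_iff_index_eq)
    also have "\<dots> = card ((!) \<sigma> ` {j. j < length xs \<and> \<sigma> ! j \<le> \<sigma> ! i})"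
      using dist len by (simp add: card_image inj_on_def nth_eq_iff_index_eq)
    also have "(!) \<sigma> ` {j. j < length xs \<and> \<sigma> ! j \<le> \<sigma> ! i} = {y \<in> set \<sigma>. y \<le> \<sigma> ! i}"
      using len by (auto simp: in_set_conv_nth)
    also have "\<dots> = {1..\<sigma> ! i}"
    proof -
      have "\<sigma> ! i \<in> set \<sigma>" using i len by simp
      then show ?thesis unfolding set by auto
    qed
    finally show "\<sigma> ! i = map (\<lambda>x. card {y \<in> set xs. y \<le> x}) xs ! i"
      using i by simp
  qed (use len in simp)
qed

definition restr :: "nat \<Rightarrow> nat list \<Rightarrow> nat list" where
  "restr i \<pi> = flattening (take i \<pi>)"

definition lrm_positions :: "nat list \<Rightarrow> nat set" where
  "lrm_positions \<pi> = {j \<in> {1..length \<pi>}. \<forall>i\<in>{1..<j}. entry \<pi> i < entry \<pi> j}"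

definition lrm :: "nat list \<Rightarrow> nat" where
  "lrm \<pi> = card (lrm_positions \<pi>)"

definition E_LRM :: "nat list multiset \<Rightarrow> real" where
  "E_LRM K = (\<Sum>\<pi>\<in>#K. real (lrm \<pi>)) / real (size K)"

definition stops_at :: "nat list set \<Rightarrow> nat list \<Rightarrow> nat \<Rightarrow> bool" where
  "stops_at A \<pi> i \<longleftrightarrow>
     i \<in> {1..length \<pi>} \<and> restr i \<pi> \<in> A \<and> (\<forall>j\<in>{1..<i}. restr j \<pi> \<notin> A)"

definition wins :: "nat \<Rightarrow> nat list set \<Rightarrow> nat list \<Rightarrow> bool" where
  "wins N A \<pi> \<longleftrightarrow> (\<exists>i. stops_at A \<pi> i \<and> entry \<pi> i = N)"

text \<open>\<^const>\<open>pmf_of_multiset\<close> is only meaningful for a nonempty multiset.\<close>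

definition strike_win_prob :: "nat \<Rightarrow> nat list multiset \<Rightarrow> nat list set \<Rightarrow> real" where
  "strike_win_prob N I A = measure_pmf.prob (pmf_of_multiset I) {\<pi>. wins N A \<pi>}"

definition prefix_tree :: "nat \<Rightarrow> nat list set" where
  "prefix_tree N = {p \<in> (\<Union>i\<in>{1..N}. perms i). length p \<in> lrm_positions p}"

definition contains :: "nat list \<Rightarrow> nat list \<Rightarrow> bool" where
  "contains q p \<longleftrightarrow> length p \<le> length q \<and> restr (length p) q = p"

definition maximal_antichain :: "nat \<Rightarrow> nat list set \<Rightarrow> bool" where
  "maximal_antichain N A \<longleftrightarrow> A \<subseteq> prefix_tree N \<and>
     (\<forall>p\<in>A. \<forall>q\<in>A. p \<noteq> q \<longrightarrow> \<not> contains p q \<and> \<not> contains q p) \<and>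
     (\<forall>p\<in>prefix_tree N. \<exists>q\<in>A. contains p q \<or> contains q p)"

definition strategy_indifferent :: "nat \<Rightarrow> nat list multiset \<Rightarrow> bool" where
  "strategy_indifferent N I \<longleftrightarrow>
     (\<forall>A B. maximal_antichain N A \<longrightarrow> maximal_antichain N B \<longrightarrow>
        strike_win_prob N I A = strike_win_prob N I B)"

text \<open>The common value. It is well defined for a strategy-indifferent game with \<open>N \<ge> 1\<close>,
  since \<open>{[1]}\<close> is a maximal antichain in \<open>prefix_tree N\<close>.\<close>

definition win_probability :: "nat \<Rightarrow> nat list multiset \<Rightarrow> real" where
  "win_probability N I = (THE p. \<forall>A. maximal_antichain N A \<longrightarrow> strike_win_prob N I A = p)"

definition append_max :: "nat \<Rightarrow> nat list multiset \<Rightarrow> nat list multiset" where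
  "append_max N J' = image_mset (\<lambda>\<pi>. \<pi> @ [N]) J'"

text \<open>All pairs of an element \<open>\<pi>\<close> of the multiset (each copy counted) and a left-to-right
  maximum position of \<open>\<pi>\<close>.\<close>

definition lrm_pairs :: "nat list multiset \<Rightarrow> (nat list \<times> nat) multiset" where
  "lrm_pairs J = (\<Sum>\<pi>\<in>#J. image_mset (\<lambda>i. (\<pi>, i)) (mset_set (lrm_positions \<pi>)))"

text \<open>\<^const>\<open>rel_mset\<close> matches the two multisets one-to-one, so the choices made for different
  copies of the same pair are independent of each other.\<close>

definition has_bine :: "nat \<Rightarrow> nat list multiset \<Rightarrow> nat list multiset \<Rightarrow> bool" where
  "has_bine N I J' \<longleftrightarrow>
     rel_mset (\<lambda>(\<pi>, i) \<tau>. \<tau> \<in> perms N \<and> restr i \<tau> = restr i \<pi> \<and> entry \<tau> i = N)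
       (lrm_pairs (append_max N J')) I"

end

theory Submission
  imports Defs
begin

text \<open>
  By strategy indifference it suffices to evaluate the strategy that stops at the first position,
  whose strike set \<open>{[1]}\<close> is a maximal antichain. It wins exactly on the competitors created for the
  left-to-right maximum position 1, of which each element of \<open>J'\<close> contributes one, while \<open>I\<close> has
  one element per left-to-right maximum of \<open>J\<close>.
\<close>

text \<open>Matched elements satisfy \<open>P\<close> and \<open>Q\<close> together, so counts
  transfer along the one-to-one matching. This lets competitors in \<open>I\<close> be counted
  through the pairs they come from.\<close>

lemma size_filter_rel_mset:
  assumes "rel_mset R M M'" and "\<And>x y. x \<in># M \<Longrightarrow> R x y \<Longrightarrow> P x \<longleftrightarrow> Q y"
  shows "size (filter_mset P M) = size (filter_mset Q M')"
  using assms
proof (induction rule: rel_mset_induct)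
  case (add R a b M M')
  have "P a \<longleftrightarrow> Q b"
    by (rule add.prems) (simp_all add: add.hyps)
  moreover have "size (filter_mset P M) = size (filter_mset Q M')"
    by (rule add.IH, rule add.prems) simp_all
  ultimately show ?case by simp
qed simp

lemma measure_pmf_of_multiset:
  assumes "M \<noteq> {#}"
  shows "measure_pmf.prob (pmf_of_multiset M) {x. P x} = size (filter_mset P M) / size M"
proof -
  have "measure_pmf.prob (pmf_of_multiset M) {x. P x} =
      measure_pmf.prob (pmf_of_multiset M) {x \<in> set_mset M. P x}"
    \<comment> \<open>Outside the support every mass is zero; cutting down to it makes the event
      finite, so its probability is a finite sum.\<close>
    by (rule measure_prob_cong_0) (auto simp: assms not_in_iff)
  also have "\<dots> = (\<Sum>x\<in>{x \<in> set_mset M. P x}. count M x / size M)"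
    by (simp add: measure_measure_pmf_finite assms)
  also have "\<dots> = size (filter_mset P M) / size M"
    by (simp add: size_multiset_overloaded_eq sum_divide_distrib)
  finally show ?thesis .
qed

lemma size_lrm_pairs: "size (lrm_pairs K) = (\<Sum>\<pi>\<in>#K. lrm \<pi>)"
  unfolding lrm_pairs_def by (induction K) (simp_all add: lrm_def)

lemma one_in_lrm_positions: "1 \<in> lrm_positions \<pi> \<longleftrightarrow> \<pi> \<noteq> []"
  by (cases \<pi>) (auto simp: lrm_positions_def)

lemma finite_lrm_positions: "finite (lrm_positions \<pi>)"
  by (simp add: lrm_positions_def)

lemma in_lrm_pairs_iff:
  "z \<in># lrm_pairs K \<longleftrightarrow> fst z \<in># K \<and> snd z \<in> lrm_positions (fst z)"
  unfolding lrm_pairs_def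
proof (induction K)
  case (add \<pi> K)
  then show ?case
    by (cases z) (auto simp: finite_lrm_positions)
qed simp

text \<open>Position 1 is vacuously a left-to-right maximum position of any nonempty list, so each
  element of \<open>K\<close> yields exactly one such pair.\<close>

lemma size_first_lrm_pairs:
  assumes "[] \<notin># K"
  shows "size {#z \<in># lrm_pairs K. snd z = 1#} = size K"
  using assms unfolding lrm_pairs_def
proof (induction K)
  case (add \<pi> K)
  have "{i \<in> lrm_positions \<pi>. i = 1} = {1}"
    using one_in_lrm_positions[of \<pi>] add.prems by auto
  then have "{#i \<in># mset_set (lrm_positions \<pi>). i = 1#} = {#1#}"
    by (simp add: filter_mset_mset_set finite_lrm_positions)
  with add show ?case
    by (simp add: filter_mset_image_mset)
qed simp

text \<open>Whether a position is a left-to-right maximum depends only on the entries up to it, so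
  the old positions persist and the new last one joins them.\<close>

lemma lrm_append_max:
  assumes "\<And>x. x \<in> set \<pi> \<Longrightarrow> x < m"
  shows "lrm (\<pi> @ [m]) = Suc (lrm \<pi>)"
proof -
  have "lrm_positions (\<pi> @ [m]) = insert (Suc (length \<pi>)) (lrm_positions \<pi>)"
    using assms by (auto simp: lrm_positions_def entry_def nth_append le_Suc_eq)
  moreover have "Suc (length \<pi>) \<notin> lrm_positions \<pi>"
    by (simp add: lrm_positions_def)
  ultimately show ?thesis
    by (simp add: lrm_def finite_lrm_positions)
qed

lemma sum_lrm_append_max:
  assumes "set_mset J' \<subseteq> perms (N - 1)"
  shows "(\<Sum>\<pi>\<in>#append_max N J'. lrm \<pi>) = (\<Sum>\<pi>\<in>#J'. lrm \<pi>) + size J'"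
  using assms unfolding append_max_def
proof (induction J')
  case (add \<pi> K)
  have "lrm (\<pi> @ [N]) = Suc (lrm \<pi>)"
  proof (rule lrm_append_max)
    have "set \<pi> = {1..N - 1}"
      using add.prems by (simp add: permutations_of_setD)
    then show "x < N" if "x \<in> set \<pi>" for x
      using that by auto
  qed
  with add show ?case by simp
qed simp

lemma restr_1:
  assumes "\<pi> \<noteq> []"
  shows "restr 1 \<pi> = [1]"
  using assms by (cases \<pi>) (auto simp: restr_def flattening_eq Collect_conv_if)

text \<open>Every nonempty permutation restricts to \<open>[1]\<close> at length 1, so
  \<open>[1]\<close> is the root of the prefix tree and comparable to everything in it.\<close>

lemma maximal_antichain_root:
  assumes "N \<ge> 1"
  shows "maximal_antichain N {[1]}"
proof -
  have "[1] \<in> prefix_tree N"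
    using assms one_in_lrm_positions[of "[1]"]
    by (auto simp: prefix_tree_def permutations_of_set_def intro!: bexI[of _ 1])
  moreover have "contains p [1]" if "p \<in> prefix_tree N" for p
  proof -
    have "p \<noteq> []"
      using that by (auto simp: prefix_tree_def lrm_positions_def)
    then show ?thesis
      using restr_1[of p] by (auto simp: contains_def Suc_le_eq)
  qed
  ultimately show ?thesis
    by (auto simp: maximal_antichain_def)
qed

lemma wins_root:
  assumes "\<pi> \<noteq> []"
  shows "wins N {[1]} \<pi> \<longleftrightarrow> entry \<pi> 1 = N"
proof -
  have "stops_at {[1]} \<pi> i \<longleftrightarrow> i = 1" for i
    using assms restr_1[OF assms] by (cases "i = 1") (auto simp: stops_at_def Suc_le_eq)
  then show ?thesis by (simp add: wins_def)
qed

text \<open>A permutation takes the value \<open>N\<close> only once. Hence the first entry of a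
  competitor reveals whether it was created for position 1.\<close>

lemma entry_eq_iff:
  assumes "\<tau> \<in> perms N" "i \<in> {1..N}" "entry \<tau> i = N"
  shows "i = 1 \<longleftrightarrow> entry \<tau> 1 = N"
proof -
  have \<tau>: "distinct \<tau>" "length \<tau> = N"
    using assms(1) by (auto dest: permutations_of_setD length_finite_permutations_of_set)
  have "i - 1 < length \<tau>" "0 < length \<tau>"
    using assms(2) \<tau>(2) by auto
  from nth_eq_iff_index_eq[OF \<tau>(1) this] have "entry \<tau> i = entry \<tau> 1 \<longleftrightarrow> i - 1 = 0"
    by (simp only: entry_def diff_self_eq_0)
  \<comment> \<open>Truncated subtraction would also give 0 at \<open>i = 0\<close>, which the range
    of \<open>i\<close> excludes.\<close>
  moreover have "i - 1 = 0 \<longleftrightarrow> i = 1"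
    using assms(2) by auto
  ultimately show ?thesis
    unfolding assms(3) by metis
qed

lemma E_LRM_eq: "E_LRM K = real (\<Sum>\<pi>\<in>#K. lrm \<pi>) / real (size K)"
proof -
  have "(\<Sum>\<pi>\<in>#K. real (lrm \<pi>)) = real (\<Sum>\<pi>\<in>#K. lrm \<pi>)"
    by (induction K) simp_all
  then show ?thesis
    by (simp add: E_LRM_def)
qed

theorem lemma2p10:
  fixes N :: nat and J' J I :: "nat list multiset"
  assumes "N \<ge> 1"
    and "J' \<noteq> {#}"
    and "set_mset J' \<subseteq> perms (N - 1)"
    and "J = append_max N J'"
    and "set_mset I \<subseteq> perms N"
    and "strategy_indifferent N I"
    and "has_bine N I J'"
  shows "win_probability N I = 1 / (E_LRM J' + 1)
    \<and> 1 / (E_LRM J' + 1) = 1 / E_LRM J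
    \<and> real (size I) = real (size J') * (E_LRM J' + 1)"
proof -
  let ?R = "\<lambda>(\<pi>, i) \<tau>. \<tau> \<in> perms N \<and> restr i \<tau> = restr i \<pi> \<and> entry \<tau> i = N"
  let ?S = "\<Sum>\<pi>\<in>#J'. lrm \<pi>"
  let ?P = "lrm_pairs J"
  have J': "size J' > 0"
    using assms(2) by (simp add: nonempty_has_size)
  have sizeJ: "size J = size J'" and "[] \<notin># J"
    unfolding assms(4) append_max_def by auto
  have sumJ: "(\<Sum>\<pi>\<in>#J. lrm \<pi>) = ?S + size J'"
    unfolding assms(4) by (rule sum_lrm_append_max[OF assms(3)])
  have rel: "rel_mset ?R ?P I"
    using assms(4,7) by (simp add: has_bine_def)
  have E: "E_LRM J' + 1 = (?S + size J') / size J'"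
    using assms(2) by (simp add: E_LRM_eq add_divide_distrib)
  have E_J: "E_LRM J = (?S + size J') / size J'"
    unfolding E_LRM_eq sizeJ sumJ by simp
  have sizeI: "size I = ?S + size J'"
    using rel_mset_size[OF rel] by (simp add: size_lrm_pairs sumJ)
  \<comment> \<open>The games won by stopping at once are counted on the side of the pairs.\<close>
  have "size {#\<tau> \<in># I. entry \<tau> 1 = N#} = size {#z \<in># ?P. snd z = 1#}"
  proof (rule size_filter_rel_mset[OF rel, symmetric])
    fix z \<tau> assume z: "z \<in># ?P" and R: "?R z \<tau>"
    have \<pi>: "fst z \<in># J" "snd z \<in> lrm_positions (fst z)"
      using z by (simp_all add: in_lrm_pairs_iff)
    from \<pi>(1) obtain \<sigma> where "fst z = \<sigma> @ [N]" "\<sigma> \<in># J'"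
      unfolding assms(4) append_max_def by auto
    \<comment> \<open>Here \<open>N \<ge> 1\<close> matters: it makes \<open>N - 1\<close> plus the
      appended entry equal to \<open>N\<close>.\<close>
    then have "length (fst z) = N"
      using assms(1,3) length_finite_permutations_of_set[of \<sigma> "{1..N - 1}"] by auto
    with \<pi>(2) have "snd z \<in> {1..N}"
      by (simp add: lrm_positions_def)
    then show "snd z = 1 \<longleftrightarrow> entry \<tau> 1 = N"
      using R by (intro entry_eq_iff) (simp_all add: case_prod_beta)
  qed
  also have "\<dots> = size J'"
    using size_first_lrm_pairs[OF \<open>[] \<notin># J\<close>] sizeJ by simp
  finally have first: "size {#\<tau> \<in># I. entry \<tau> 1 = N#} = size J'" .
  have "\<tau> \<noteq> []" if "\<tau> \<in># I" for \<tau>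
    using that assms(1,5) length_finite_permutations_of_set[of \<tau> "{1..N}"] by auto
  then have "{#\<tau> \<in># I. wins N {[1]} \<tau>#} = {#\<tau> \<in># I. entry \<tau> 1 = N#}"
    by (intro filter_mset_cong refl wins_root)
  with first have "size {#\<tau> \<in># I. wins N {[1]} \<tau>#} = size J'"
    by simp
  moreover have "I \<noteq> {#}"
    using sizeI J' by auto
  ultimately have root: "strike_win_prob N I {[1]} = size J' / size I"
    by (simp add: strike_win_prob_def measure_pmf_of_multiset)
  \<comment> \<open>Indifference gives existence of the common value; evaluating any candidate at
    the antichain \<open>{[1]}\<close> gives its uniqueness.\<close>
  have "win_probability N I = strike_win_prob N I {[1]}"
    unfolding win_probability_def
  proof (rule the_equality)
    show "\<forall>A. maximal_antichain N A \<longrightarrow> strike_win_prob N I A = strike_win_prob N I {[1]}"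
      using assms(6) maximal_antichain_root[OF assms(1)] unfolding strategy_indifferent_def
      by blast
  qed (use maximal_antichain_root[OF assms(1)] in blast)
  \<comment> \<open>The root value \<open>size J' / size I\<close> is the reciprocal of
    \<open>(?S + size J') / size J'\<close>, which is both \<open>E_LRM J' + 1\<close> and
    \<open>E_LRM J\<close>.\<close>
  with root show ?thesis
    using J' by (simp add: E E_J sizeI)
qed

end
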